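(* Let $\mathcal{X}$ (states) and $\mathcal{A}$ (actions) be finite nonempty sets, $\gamma\in[0,1)$, and let $P(\cdot|x,a)$ be a probability distribution on $\mathcal{X}$ for each $(x,a)\in\mathcal{X}\times\mathcal{A}$. For each $\theta\in\mathbb{R}^d$ let $r_\theta:\mathcal{X}\times\mathcal{A}\to\mathbb{R}$ be a reward function, and let $Q_\theta^*:\mathcal{X}\times\mathcal{A}\to\mathbb{R}$ be the optimal action-value function of the discounted Markovian decision problem $(\mathcal{X},\mathcal{A},\gamma,P,r_\theta)$. Assume that $r_\theta(x,a)$ is differentiable with respect to $\theta$ for every $(x,a)$, with uniformly bounded derivatives: $\sup_{(\theta,x,a)\in\mathbb{R}^d\times\mathcal{X}\times\mathcal{A}} \|r'_\theta(x,a)\| < +\infty$, where $r'_\theta(x,a)$ is the derivative (row vector) with respect to $\theta$. Then: (1) $Q_\theta^*$ is uniformly Lipschitz-continuous as a function of $\theta$: there is $L'>0$ such that for every $(x,a)\in\mathcal{X}\times\mathcal{A}$ and all $\theta,\theta'\in\mathbb{R}^d$, $|Q_\theta^*(x,a)-Q_{\theta'}^*(x,a)|\le L'\|\theta-\theta'\|$. (2) Except for $\theta$ in a set of Lebesgue measure zero, the gradient $\nabla_\theta Q_\theta^*(x,a)\in\mathbb{R}^d$ exists for all $(x,a)$ and is given by the solution $\varphi_\theta:\mathcal{X}\times\mathcal{A}\to\mathbb{R}^d$ of the fixed-point equation $$\varphi_\theta(x,a) = (r'_\theta(x,a))^T + \gamma\sum_{y\in\mathcal{X}}P(y|x,a)\sum_{b\in\mathcal{A}}\pi(b|y)\,\varphi_\theta(y,b),\qquad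 (x,a)\in\mathcal{X}\times\mathcal{A},$$ that is, $\nabla_\theta Q^*_\theta(x,a)=\varphi_\theta(x,a)$ for all $(x,a)$, where $\pi$ is any policy that is greedy with respect to $Q_\theta^*$.
   Context: $\|\cdot\|$ is the $\ell^2$-norm. A (stationary stochastic) policy is a map $\pi$ with $\pi(a|x)\in[0,1]$ and $\sum_{a\in\mathcal{A}}\pi(a|x)=1$ for all $x\in\mathcal{X}$. The action-value function of a policy $\pi$ for reward $r$ is $Q^\pi(x,a)=\mathbb{E}\big[\sum_{t=0}^\infty\gamma^t r(X_t,A_t)\mid X_0=x,A_0=a\big]$, where $X_{t+1}\sim P(\cdot|X_t,A_t)$ and $A_t\sim\pi(\cdot|X_t)$ for $t>0$. The optimal action-value function is $Q^*(x,a)=\sup_\pi Q^\pi(x,a)$; it is the unique solution of the Bellman optimality equation $Q^*(x,a)=r(x,a)+\gamma\sum_{y\in\mathcal{X}}P(y|x,a)\max_{b\in\mathcal{A}}Q^*(y,b)$. A policy $\pi$ is greedy with respect to $Q:\mathcal{X}\times\mathcal{A}\to\mathbb{R}$ if $\sum_{a\in\mathcal{A}}\pi(a|x)Q(x,a)=\max_{a\in\mathcal{A}}Q(x,a)$ for all $x\in\mathcal{X}$. *)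

theory Defs
  imports "HOL-Probability.Probability"
begin

text \<open>
  Finite state and action spaces are finite types \<open>'x\<close> and \<open>'a\<close>. The transition kernel is
  \<open>P :: 'x \<Rightarrow> 'a \<Rightarrow> 'x pmf\<close>, with \<open>P(y|x,a) = pmf (P x a) y\<close>; a stationary stochastic policy is
  \<open>\<pi> :: 'x \<Rightarrow> 'a pmf\<close>, with \<open>\<pi>(a|x) = pmf (\<pi> x) a\<close>.
\<close>

text \<open>
  The law of \<open>(X\<^sub>n, A\<^sub>n)\<close> given the history \<open>\<omega> 0, \<dots>, \<omega> (n - 1)\<close>, for the process started in \<open>z\<close>.
\<close>

definition mdp_step ::
  "('x \<Rightarrow> 'a \<Rightarrow> 'x pmf) \<Rightarrow> ('x \<Rightarrow> 'a pmf) \<Rightarrow> 'x \<times> 'a \<Rightarrow> nat \<Rightarrow> (nat \<Rightarrow> 'x \<times> 'a) \<Rightarrow> ('x \<times> 'a) pmf"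
where
  "mdp_step P \<pi> z n \<omega> = (case n of
      0 \<Rightarrow> return_pmf z
    | Suc m \<Rightarrow> (case \<omega> m of (x, a) \<Rightarrow>
        bind_pmf (P x a) (\<lambda>y. bind_pmf (\<pi> y) (\<lambda>b. return_pmf (y, b)))))"

text \<open>
  The law of the whole trajectory \<open>(X\<^sub>t, A\<^sub>t)\<^sub>t\<close>, obtained from the one-step laws by the
  Ionescu-Tulcea theorem; \<open>emeasure_trajectory\<close> below gives its finite-horizon laws.
\<close>

definition trajectory ::
  "('x \<Rightarrow> 'a \<Rightarrow> 'x pmf) \<Rightarrow> ('x \<Rightarrow> 'a pmf) \<Rightarrow> 'x \<times> 'a \<Rightarrow> (nat \<Rightarrow> 'x \<times> 'a) measure"
where
  "trajectory P \<pi> z = projective_family.lim UNIV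
     (Ionescu_Tulcea.CI (\<lambda>n \<omega>. measure_pmf (mdp_step P \<pi> z n \<omega>)) (\<lambda>_. count_space UNIV))
     (\<lambda>_. count_space UNIV)"

definition policy_Q ::
  "('x \<Rightarrow> 'a \<Rightarrow> 'x pmf) \<Rightarrow> real \<Rightarrow> ('x \<Rightarrow> 'a \<Rightarrow> real) \<Rightarrow> ('x \<Rightarrow> 'a pmf) \<Rightarrow> 'x \<Rightarrow> 'a \<Rightarrow> real"
where
  "policy_Q P \<gamma> r \<pi> x a =
     (\<integral>\<omega>. (\<Sum>t. \<gamma> ^ t * r (fst (\<omega> t)) (snd (\<omega> t))) \<partial>trajectory P \<pi> (x, a))"

definition optimal_Q ::
  "('x \<Rightarrow> 'a \<Rightarrow> 'x pmf) \<Rightarrow> real \<Rightarrow> ('x \<Rightarrow> 'a \<Rightarrow> real) \<Rightarrow> 'x \<Rightarrow> 'a \<Rightarrow> real"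
where
  "optimal_Q P \<gamma> r x a = (SUP \<pi>. policy_Q P \<gamma> r \<pi> x a)"

definition greedy :: "('x \<Rightarrow> 'a::finite pmf) \<Rightarrow> ('x \<Rightarrow> 'a \<Rightarrow> real) \<Rightarrow> bool"
where
  "greedy \<pi> Q \<longleftrightarrow> (\<forall>x. (\<Sum>a\<in>UNIV. pmf (\<pi> x) a * Q x a) = Max (range (Q x)))"

definition gradient_equation ::
  "('x::finite \<Rightarrow> 'a::finite \<Rightarrow> 'x pmf) \<Rightarrow> real \<Rightarrow> ('x \<Rightarrow> 'a \<Rightarrow> 'v::real_vector) \<Rightarrow> ('x \<Rightarrow> 'a pmf)
    \<Rightarrow> ('x \<Rightarrow> 'a \<Rightarrow> 'v) \<Rightarrow> bool"
where
  "gradient_equation P \<gamma> r' \<pi> \<phi> \<longleftrightarrow> (\<forall>x a. \<phi> x a =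
     r' x a + \<gamma> *\<^sub>R (\<Sum>y\<in>UNIV. pmf (P x a) y *\<^sub>R (\<Sum>b\<in>UNIV. pmf (\<pi> y) b *\<^sub>R \<phi> y b)))"

lemma Ionescu_Tulcea_mdp_step:
  fixes P :: "'x::finite \<Rightarrow> 'a::finite \<Rightarrow> 'x pmf"
  shows "Ionescu_Tulcea (\<lambda>n \<omega>. measure_pmf (mdp_step P \<pi> z n \<omega>)) (\<lambda>_. count_space UNIV)"
proof
  fix n
  have "measure_pmf (mdp_step P \<pi> z n \<omega>) \<in> space (subprob_algebra (count_space UNIV))" for \<omega>
    by (simp add: space_subprob_algebra measure_pmf.subprob_space_axioms)
  then show "(\<lambda>\<omega>. measure_pmf (mdp_step P \<pi> z n \<omega>))
      \<in> PiM {0..<n} (\<lambda>_. count_space UNIV) \<rightarrow>\<^sub>M subprob_algebra (count_space UNIV)"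
    by (simp add: count_space_PiM_finite)
qed

lemma sets_trajectory:
  fixes P :: "'x::finite \<Rightarrow> 'a::finite \<Rightarrow> 'x pmf"
  shows "sets (trajectory P \<pi> z) = sets (PiM UNIV (\<lambda>_. count_space UNIV))"
proof -
  interpret Ionescu_Tulcea "\<lambda>n \<omega>. measure_pmf (mdp_step P \<pi> z n \<omega>)" "\<lambda>_. count_space UNIV"
    by (rule Ionescu_Tulcea_mdp_step)
  show ?thesis
    unfolding trajectory_def by simp
qed

lemma mdp_step_cong: "(\<And>m. m < n \<Longrightarrow> \<omega> m = \<omega>' m) \<Longrightarrow> mdp_step P \<pi> z n \<omega> = mdp_step P \<pi> z n \<omega>'"
  by (cases n) (simp_all add: mdp_step_def)

lemma pmf_mdp_step:
  "pmf (mdp_step P \<pi> z 0 \<omega>) w = (if w = z then 1 else 0)"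
  "pmf (mdp_step P \<pi> z (Suc n) \<omega>) (y, b) = pmf (P (fst (\<omega> n)) (snd (\<omega> n))) y * pmf (\<pi> y) b"
proof -
  show "pmf (mdp_step P \<pi> z 0 \<omega>) w = (if w = z then 1 else 0)"
    by (simp add: mdp_step_def)
  have "pmf (bind_pmf (\<pi> y') (\<lambda>b. return_pmf (y', b))) (y, b) = indicator {y} y' * pmf (\<pi> y) b" for y'
  proof (cases "y' = y")
    case True
    then show ?thesis
      using pmf_map_inj'[of "Pair y" "\<pi> y" b] by (simp add: map_pmf_def inj_on_def)
  next
    case False
    then have "(y, b) \<notin> set_pmf (bind_pmf (\<pi> y') (\<lambda>b. return_pmf (y', b)))"
      by auto
    with False show ?thesis
      by (simp add: set_pmf_iff del: set_bind_pmf)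
  qed
  then show "pmf (mdp_step P \<pi> z (Suc n) \<omega>) (y, b)
      = pmf (P (fst (\<omega> n)) (snd (\<omega> n))) y * pmf (\<pi> y) b"
    by (simp add: mdp_step_def split_beta pmf_bind measure_pmf_single)
qed

theorem emeasure_trajectory:
  fixes P :: "'x::finite \<Rightarrow> 'a::finite \<Rightarrow> 'x pmf"
  shows "emeasure (trajectory P \<pi> z) {\<omega>. \<forall>i<n. \<omega> i = w i}
    = (\<Prod>i<n. ennreal (pmf (mdp_step P \<pi> z i w) (w i)))"
proof -
  let ?M = "\<lambda>_::nat. count_space (UNIV :: ('x \<times> 'a) set)"
  interpret Ionescu_Tulcea "\<lambda>n \<omega>. measure_pmf (mdp_step P \<pi> z n \<omega>)" ?M
    by (rule Ionescu_Tulcea_mdp_step)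
  have fin: "PiM {0..<n} ?M = count_space (PiE {0..<n} (\<lambda>_. UNIV))" for n
    by (simp add: count_space_PiM_finite)
  have C: "emeasure (C 0 n (\<lambda>_. undefined)) {restrict w {0..<n}}
      = (\<Prod>i<n. ennreal (pmf (mdp_step P \<pi> z i w) (w i)))" for n
  proof (induction n)
    case 0
    show ?case by (simp add: PiM_empty)
  next
    case (Suc n)
    let ?w = "restrict w {0..<n}" and ?w' = "restrict w {0..<Suc n}"
    have sp: "space (C 0 n (\<lambda>_. undefined)) = PiE {0..<n} (\<lambda>_. UNIV)"
      by (subst space_C) (simp_all add: space_PiM)
    have "emeasure (C 0 (Suc n) (\<lambda>_. undefined)) {?w'}
        = (\<integral>\<^sup>+\<omega>. emeasure (eP n \<omega>) {?w'} \<partial>C 0 n (\<lambda>_. undefined))"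
      using measurable_eP[of n]
      by (simp, subst emeasure_bind[where N="PiM {0..<Suc n} ?M"])
         (auto simp: sp space_PiM fin measurable_cong_sets[OF sets_C[of _ 0] refl])
    also have "\<dots> = (\<integral>\<^sup>+\<omega>. ennreal (pmf (mdp_step P \<pi> z n w) (w n)) * indicator {?w} \<omega>
        \<partial>C 0 n (\<lambda>_. undefined))"
    proof (rule nn_integral_cong)
      fix \<omega> assume "\<omega> \<in> space (C 0 n (\<lambda>_. undefined))"
      then have \<omega>: "\<omega> \<in> PiE {0..<n} (\<lambda>_. UNIV)" by (simp add: sp)
      then have *: "emeasure (eP n \<omega>) {?w'}
          = emeasure (measure_pmf (mdp_step P \<pi> z n \<omega>)) (fun_upd \<omega> n -` {?w'})"
        by (subst emeasure_eP) (auto simp: space_PiM fin[of "Suc n"])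
      show "emeasure (eP n \<omega>) {?w'}
          = ennreal (pmf (mdp_step P \<pi> z n w) (w n)) * indicator {?w} \<omega>"
      proof (cases "\<omega> = ?w")
        case True
        have "fun_upd \<omega> n x = ?w' \<longleftrightarrow> x = w n" for x
        proof
          assume "fun_upd \<omega> n x = ?w'"
          then show "x = w n" by (auto dest!: fun_cong[of _ _ n])
        next
          assume "x = w n"
          with True show "fun_upd \<omega> n x = ?w'" by (simp add: fun_eq_iff)
        qed
        then have "fun_upd \<omega> n -` {?w'} = {w n}"
          by (simp add: vimage_def)
        moreover have "mdp_step P \<pi> z n \<omega> = mdp_step P \<pi> z n w"
          using True by (intro mdp_step_cong) auto
        ultimately show ?thesis
          using True * by (simp add: emeasure_pmf_single)
      next
        case False
        have "fun_upd \<omega> n x \<noteq> ?w'" for x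
        proof
          assume "fun_upd \<omega> n x = ?w'"
          then have "\<omega> i = w i" if "i < n" for i
            using that by (auto dest!: fun_cong[of _ _ i])
          with \<omega> False show False
            by (auto simp: fun_eq_iff PiE_def extensional_def restrict_def split: if_splits)
        qed
        then have "fun_upd \<omega> n -` {?w'} = {}" by auto
        with False * show ?thesis by simp
      qed
    qed
    also have "\<dots> = ennreal (pmf (mdp_step P \<pi> z n w) (w n)) * emeasure (C 0 n (\<lambda>_. undefined)) {?w}"
      by (subst nn_integral_cmult_indicator) (auto simp: sets_C fin[of n] space_PiM)
    finally show ?case
      by (simp only: Suc.IH prod.lessThan_Suc mult.commute)
  qed
  have cyl: "{\<omega>. \<forall>i<n. \<omega> i = w i} = PF.emb UNIV {0..<n} {restrict w {0..<n}}"
  proof -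
    have "(\<forall>i<n. \<omega> i = w i) \<longleftrightarrow> restrict \<omega> {0..<n} = restrict w {0..<n}" for \<omega>
      by (metis (no_types, lifting) atLeastLessThan_iff restrict_apply' restrict_ext zero_le)
    then show ?thesis
      by (auto simp: prod_emb_def space_PiM)
  qed
  have "emeasure (trajectory P \<pi> z) {\<omega>. \<forall>i<n. \<omega> i = w i} = emeasure (CI {0..<n}) {restrict w {0..<n}}"
    unfolding cyl trajectory_def by (rule lim) (auto simp: fin[of n])
  also have "\<dots> = emeasure (C 0 n (\<lambda>_. undefined)) {restrict w {0..<n}}"
    by (subst emeasure_CI[of _ n]) (auto simp: fin[of n] intro!: arg_cong[of _ _ "emeasure _"] prod_emb_id)
  finally show ?thesis
    by (simp add: C)
qed

corollary prob_space_trajectory: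
  fixes P :: "'x::finite \<Rightarrow> 'a::finite \<Rightarrow> 'x pmf"
  shows "prob_space (trajectory P \<pi> z)"
proof (rule prob_spaceI)
  have "space (trajectory P \<pi> z) = UNIV"
    using sets_eq_imp_space_eq[OF sets_trajectory, of P \<pi> z] by (simp add: space_PiM)
  then show "emeasure (trajectory P \<pi> z) (space (trajectory P \<pi> z)) = 1"
    using emeasure_trajectory[of P \<pi> z 0 undefined] by simp
qed

end

(* Some deterministic policy attains the supremum defining the optimal action-value function, so
   that function is a maximum of finitely many action-value functions. Each of these is linear in
   the reward, hence differentiable in theta, and its gradient solves the fixed-point equation for
   its policy. The maximum can fail to be differentiable only where two of them agree with
   different gradients, and the set where a differentiable function vanishes while its gradient
   does not is Lebesgue null; this avoids Rademacher's theorem. Off the null set, the action-value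
   function of a greedy policy touches the optimal one from below, so the gradients coincide. *)
theory Submission
  imports Defs
begin

section \<open>One-step averages and the fixed-point equation of a policy\<close>

text \<open>The values lie in an arbitrary real vector space, so that one operator serves both the
  real action values and the gradients in \<theta>.\<close>

definition next_value ::
  "('x::finite \<Rightarrow> 'a::finite \<Rightarrow> 'x pmf) \<Rightarrow> ('x \<Rightarrow> 'a pmf) \<Rightarrow> ('x \<Rightarrow> 'a \<Rightarrow> 'v::real_vector) \<Rightarrow> 'x \<Rightarrow> 'a \<Rightarrow> 'v"
where
  "next_value P \<pi> f x a = (\<Sum>y\<in>UNIV. pmf (P x a) y *\<^sub>R (\<Sum>b\<in>UNIV. pmf (\<pi> y) b *\<^sub>R f y b))"

lemma gradient_equation_iff:
  "gradient_equation P \<gamma> r \<pi> \<phi> \<longleftrightarrow> (\<forall>x a. \<phi> x a = r x a + \<gamma> *\<^sub>R next_value P \<pi> \<phi> x a)"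
  by (simp add: gradient_equation_def next_value_def)

lemma next_value_diff: "next_value P \<pi> (\<lambda>x a. f x a - g x a) x a = next_value P \<pi> f x a - next_value P \<pi> g x a"
  by (simp add: next_value_def scaleR_right_diff_distrib sum_subtractf)

lemma next_value_sum_scaleR:
  "next_value P \<pi> (\<lambda>x a. \<Sum>i\<in>I. f i x a *\<^sub>R v i) x a = (\<Sum>i\<in>I. next_value P \<pi> (f i) x a *\<^sub>R v i)"
proof -
  have "(\<Sum>b\<in>UNIV. pmf (\<pi> y) b *\<^sub>R (\<Sum>i\<in>I. f i y b *\<^sub>R v i))
      = (\<Sum>i\<in>I. (\<Sum>b\<in>UNIV. pmf (\<pi> y) b * f i y b) *\<^sub>R v i)" for y
    unfolding scaleR_sum_right scaleR_sum_left scaleR_scaleR by (rule sum.swap)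
  then have "next_value P \<pi> (\<lambda>x a. \<Sum>i\<in>I. f i x a *\<^sub>R v i) x a
      = (\<Sum>y\<in>UNIV. \<Sum>i\<in>I. (pmf (P x a) y * (\<Sum>b\<in>UNIV. pmf (\<pi> y) b * f i y b)) *\<^sub>R v i)"
    by (simp add: next_value_def scaleR_sum_right)
  also have "\<dots> = (\<Sum>i\<in>I. \<Sum>y\<in>UNIV. (pmf (P x a) y * (\<Sum>b\<in>UNIV. pmf (\<pi> y) b * f i y b)) *\<^sub>R v i)"
    by (rule sum.swap)
  finally show ?thesis
    by (simp add: next_value_def scaleR_sum_left)
qed

lemma next_value_mono:
  fixes f g :: "'x::finite \<Rightarrow> 'a::finite \<Rightarrow> real"
  assumes "\<And>x a. f x a \<le> g x a"
  shows "next_value P \<pi> f x a \<le> next_value P \<pi> g x a"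
  unfolding next_value_def real_scaleR_def using assms
  by (intro sum_mono mult_left_mono) auto

lemma next_value_const: "next_value P \<pi> (\<lambda>_ _. c) x a = c"
  by (simp add: next_value_def flip: scaleR_sum_left) (simp add: sum_pmf_eq_1)

lemma norm_next_value_le: "norm (next_value P \<pi> f x a) \<le> next_value P \<pi> (\<lambda>x a. norm (f x a)) x a"
proof -
  have "norm (\<Sum>b\<in>UNIV. pmf (\<pi> y) b *\<^sub>R f y b) \<le> (\<Sum>b\<in>UNIV. pmf (\<pi> y) b * norm (f y b))" for y
    by (rule order_trans[OF norm_sum]) simp
  then show ?thesis
    unfolding next_value_def
    by (intro order_trans[OF norm_sum] sum_mono) (simp add: mult_left_mono)
qed

text \<open>A maximum principle: at a maximiser of \<open>u\<close> the average is at most the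
  maximum \<open>m\<close>, so \<open>m \<le> c + \<gamma> * m\<close>. It takes the place of a
  contraction argument in the proofs of uniqueness, Lipschitz bounds, policy improvement and
  optimality.\<close>

lemma discounted_comparison:
  fixes u :: "'x::finite \<Rightarrow> 'a::finite \<Rightarrow> real"
  assumes "0 \<le> \<gamma>" "\<gamma> < 1"
    and u: "\<And>x a. u x a \<le> c + \<gamma> * next_value P \<pi> u x a"
  shows "u x a \<le> c / (1 - \<gamma>)"
proof -
  define m where "m = Max (range (case_prod u))"
  have le: "u x a \<le> m" for x a
    unfolding m_def by (rule Max_ge) (auto intro: rev_image_eqI[of "(x, a)"])
  have "m \<in> range (case_prod u)"
    unfolding m_def by (rule Max_in) auto
  then obtain x0 a0 where "m = u x0 a0" by auto
  also have "\<dots> \<le> c + \<gamma> * next_value P \<pi> u x0 a0" by (rule u)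
  also have "\<dots> \<le> c + \<gamma> * m"
    using next_value_mono[of u "\<lambda>_ _. m", OF le] assms(1) by (simp add: next_value_const mult_left_mono)
  finally have "m \<le> c / (1 - \<gamma>)"
    using assms(2) by (simp add: field_simps)
  with le[of x a] show ?thesis by simp
qed

text \<open>The reward cancels in the difference of two solutions, so its norm satisfies the
  comparison inequality with \<open>c = 0\<close>.\<close>

lemma gradient_equation_unique:
  fixes \<phi> \<psi> :: "'x::finite \<Rightarrow> 'a::finite \<Rightarrow> 'v::real_normed_vector"
  assumes \<gamma>: "0 \<le> \<gamma>" "\<gamma> < 1"
    and "gradient_equation P \<gamma> r \<pi> \<phi>" "gradient_equation P \<gamma> r \<pi> \<psi>"
  shows "\<phi> = \<psi>"
proof -
  define u where "u x a = norm (\<phi> x a - \<psi> x a)" for x a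
  have "u x a \<le> 0 + \<gamma> * next_value P \<pi> u x a" for x a
  proof -
    have "\<phi> x a - \<psi> x a = \<gamma> *\<^sub>R next_value P \<pi> (\<lambda>x a. \<phi> x a - \<psi> x a) x a"
      using assms(3,4) unfolding gradient_equation_iff next_value_diff scaleR_right_diff_distrib
      by (metis add_diff_cancel_left)
    then have "u x a = \<gamma> * norm (next_value P \<pi> (\<lambda>x a. \<phi> x a - \<psi> x a) x a)"
      using \<gamma>(1) by (simp add: u_def)
    then show ?thesis
      using norm_next_value_le[of P \<pi> "\<lambda>x a. \<phi> x a - \<psi> x a" x a] \<gamma>(1)
      by (simp add: u_def[abs_def] mult_left_mono)
  qed
  from discounted_comparison[OF \<gamma> this] show ?thesis
    by (simp add: u_def fun_eq_iff)
qed

section \<open>Expectations along trajectories and the Bellman equation of a policy\<close>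

text \<open>A function of the first \<open>n\<close> coordinates is a finite combination of cylinder
  indicators, and \<open>emeasure_trajectory\<close> gives the mass of each cylinder.\<close>

lemma integral_trajectory_finite_horizon:
  fixes P :: "'x::finite \<Rightarrow> 'a::finite \<Rightarrow> 'x pmf" and F :: "(nat \<Rightarrow> 'x \<times> 'a) \<Rightarrow> real"
  assumes F: "\<And>\<omega>. F \<omega> = F (restrict \<omega> {..<n})"
  shows "(\<integral>\<omega>. F \<omega> \<partial>trajectory P \<pi> z)
    = (\<Sum>w\<in>PiE {..<n} (\<lambda>_. UNIV). F w * (\<Prod>i<n. pmf (mdp_step P \<pi> z i w) (w i)))"
proof -
  let ?M = "trajectory P \<pi> z" and ?E = "PiE {..<n} (\<lambda>_. UNIV) :: (nat \<Rightarrow> 'x \<times> 'a) set"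
  let ?C = "\<lambda>w. {\<omega>. \<forall>i<n. \<omega> i = w i}"
  interpret prob_space ?M by (rule prob_space_trajectory)
  have [measurable_cong]: "sets ?M = sets (PiM UNIV (\<lambda>_. count_space UNIV))" by (rule sets_trajectory)
  have sp: "space ?M = UNIV"
    using sets_eq_imp_space_eq[OF sets_trajectory, of P \<pi> z] by (simp add: space_PiM)
  have fin: "finite ?E" by (simp add: finite_PiE)
  have C_sets: "?C w \<in> sets ?M" for w
  proof -
    have "{\<omega> \<in> space ?M. \<forall>i<n. \<omega> i = w i} \<in> sets ?M" by measurable
    then show ?thesis by (simp add: sp)
  qed
  \<comment> \<open>The cylinders over \<open>?E\<close> partition the path space; the only one
    containing \<omega> is indexed by the restriction of \<omega>.\<close>
  have "F \<omega> = (\<Sum>w\<in>?E. F w * indicator (?C w) \<omega>)" for \<omega>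
  proof -
    have "(\<Sum>w\<in>?E. F w * indicator (?C w) \<omega>) = (\<Sum>w\<in>{restrict \<omega> {..<n}}. F w * indicator (?C w) \<omega>)"
    proof (rule sum.mono_neutral_right[OF fin])
      show "\<forall>w\<in>?E - {restrict \<omega> {..<n}}. F w * indicator (?C w) \<omega> = 0"
      proof
        fix w assume w: "w \<in> ?E - {restrict \<omega> {..<n}}"
        have "\<omega> \<notin> ?C w"
        proof
          assume "\<omega> \<in> ?C w"
          with w have "w = restrict \<omega> {..<n}"
            by (intro PiE_ext[of w "{..<n}" "\<lambda>_. UNIV"]) auto
          with w show False by simp
        qed
        then show "F w * indicator (?C w) \<omega> = 0" by simp
      qed
    qed auto
    also have "\<dots> = F \<omega>" using F[of \<omega>] by simp
    finally show ?thesis by simp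
  qed
  then have "(\<integral>\<omega>. F \<omega> \<partial>?M) = (\<integral>\<omega>. (\<Sum>w\<in>?E. F w * indicator (?C w) \<omega>) \<partial>?M)"
    by (rule Bochner_Integration.integral_cong[OF refl])
  also have "\<dots> = (\<Sum>w\<in>?E. F w * measure ?M (?C w))"
    by (subst Bochner_Integration.integral_sum)
       (auto simp: C_sets sp intro!: integrable_mult_right integrable_real_indicator simp: less_top[symmetric])
  also have "\<dots> = (\<Sum>w\<in>?E. F w * (\<Prod>i<n. pmf (mdp_step P \<pi> z i w) (w i)))"
    by (simp add: measure_def emeasure_trajectory prod_ennreal prod_nonneg)
  finally show ?thesis .
qed

text \<open>The Markov property in expectation: summing over the last of \<open>t + 2\<close>
  coordinates replaces \<open>f\<close> at time \<open>t + 1\<close> by its one-step average at time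
  \<open>t\<close>.\<close>

lemma expectation_trajectory_Suc:
  fixes P :: "'x::finite \<Rightarrow> 'a::finite \<Rightarrow> 'x pmf" and f :: "'x \<Rightarrow> 'a \<Rightarrow> real"
  shows "(\<integral>\<omega>. f (fst (\<omega> (Suc t))) (snd (\<omega> (Suc t))) \<partial>trajectory P \<pi> z)
    = (\<integral>\<omega>. next_value P \<pi> f (fst (\<omega> t)) (snd (\<omega> t)) \<partial>trajectory P \<pi> z)"
proof -
  define n where "n = Suc t"
  let ?E = "\<lambda>n. PiE {..<n} (\<lambda>_. UNIV) :: (nat \<Rightarrow> 'x \<times> 'a) set"
  let ?p = "\<lambda>w. \<Prod>i<n. pmf (mdp_step P \<pi> z i w) (w i)"
  \<comment> \<open>The factors with \<open>i < n\<close> read only coordinates below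
    \<open>n\<close>, so the weight ignores coordinate \<open>n\<close>.\<close>
  have p_upd: "?p (w(n := v)) = ?p w" for w v
    by (rule prod.cong) (auto intro!: arg_cong2[where f=pmf] mdp_step_cong)
  have "(\<integral>\<omega>. case_prod f (\<omega> n) \<partial>trajectory P \<pi> z)
      = (\<Sum>w\<in>?E (Suc n). case_prod f (w n) * (\<Prod>i<Suc n. pmf (mdp_step P \<pi> z i w) (w i)))"
    by (rule integral_trajectory_finite_horizon) simp
  \<comment> \<open>A path of length \<open>n + 1\<close> is split into its last entry
    \<open>v\<close> and its first \<open>n\<close> entries, so that \<open>v\<close> can be summed
    out.\<close>
  also have "?E (Suc n) = (\<lambda>(v, w). w(n := v)) ` (UNIV \<times> ?E n)"
    by (simp add: lessThan_Suc PiE_insert_eq)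
  also have "(\<Sum>w\<in>\<dots>. case_prod f (w n) * (\<Prod>i<Suc n. pmf (mdp_step P \<pi> z i w) (w i)))
      = (\<Sum>(v, w)\<in>UNIV \<times> ?E n. case_prod f v * (?p w * pmf (mdp_step P \<pi> z n w) v))"
  proof (subst sum.reindex)
    show "inj_on (\<lambda>(v, w). w(n := v)) (UNIV \<times> ?E n)"
      by (rule inj_combinator) simp
    have "mdp_step P \<pi> z n (w(n := v)) = mdp_step P \<pi> z n w" for w v
      by (rule mdp_step_cong) simp
    then show "(\<Sum>p\<in>UNIV \<times> ?E n. ((\<lambda>w. case_prod f (w n) * (\<Prod>i<Suc n. pmf (mdp_step P \<pi> z i w) (w i)))
          \<circ> (\<lambda>(v, w). w(n := v))) p)
      = (\<Sum>(v, w)\<in>UNIV \<times> ?E n. case_prod f v * (?p w * pmf (mdp_step P \<pi> z n w) v))"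
      by (intro sum.cong refl) (clarsimp simp: p_upd simp del: fun_upd_apply, simp)
  qed
  also have "\<dots> = (\<Sum>w\<in>?E n. case_prod (next_value P \<pi> f) (w t) * ?p w)"
  proof -
    have "(\<Sum>v\<in>UNIV. case_prod f v * (?p w * pmf (mdp_step P \<pi> z n w) v))
        = case_prod (next_value P \<pi> f) (w t) * ?p w" for w
    proof -
      have "(\<Sum>v\<in>UNIV. case_prod f v * (?p w * pmf (mdp_step P \<pi> z n w) v))
          = (\<Sum>y\<in>UNIV. \<Sum>b\<in>UNIV. f y b * (?p w * pmf (mdp_step P \<pi> z n w) (y, b)))"
        by (simp add: sum.cartesian_product split_beta)
      also have "\<dots> = (\<Sum>y\<in>UNIV. pmf (P (fst (w t)) (snd (w t))) y * (\<Sum>b\<in>UNIV. pmf (\<pi> y) b * f y b)) * ?p w"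
        by (simp only: n_def pmf_mdp_step(2) sum_distrib_left sum_distrib_right mult_ac)
      finally show ?thesis by (simp add: next_value_def split_beta)
    qed
    then show ?thesis
      by (subst sum.cartesian_product[symmetric], subst sum.swap) simp
  qed
  also have "\<dots> = (\<integral>\<omega>. case_prod (next_value P \<pi> f) (\<omega> t) \<partial>trajectory P \<pi> z)"
    by (rule integral_trajectory_finite_horizon[symmetric]) (simp add: n_def)
  finally show ?thesis
    by (simp add: n_def split_beta)
qed

lemma expectation_trajectory:
  fixes P :: "'x::finite \<Rightarrow> 'a::finite \<Rightarrow> 'x pmf" and f :: "'x \<Rightarrow> 'a \<Rightarrow> real"
  shows "(\<integral>\<omega>. f (fst (\<omega> t)) (snd (\<omega> t)) \<partial>trajectory P \<pi> (x, a)) = (next_value P \<pi> ^^ t) f x a"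
proof (induction t arbitrary: f)
  case 0
  let ?E = "PiE {..<Suc 0} (\<lambda>_. UNIV) :: (nat \<Rightarrow> 'x \<times> 'a) set"
  have "(\<integral>\<omega>. case_prod f (\<omega> 0) \<partial>trajectory P \<pi> (x, a))
      = (\<Sum>w\<in>?E. case_prod f (w 0) * (\<Prod>i<Suc 0. pmf (mdp_step P \<pi> (x, a) i w) (w i)))"
    by (rule integral_trajectory_finite_horizon) simp
  also have "\<dots> = (\<Sum>w\<in>?E. if w = restrict (\<lambda>_. (x, a)) {..<Suc 0} then f x a else 0)"
  proof (rule sum.cong)
    fix w assume "w \<in> ?E"
    then have "w 0 = (x, a) \<longleftrightarrow> w = restrict (\<lambda>_. (x, a)) {..<Suc 0}"
      by (auto simp: fun_eq_iff PiE_def extensional_def)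
    then show "case_prod f (w 0) * (\<Prod>i<Suc 0. pmf (mdp_step P \<pi> (x, a) i w) (w i))
        = (if w = restrict (\<lambda>_. (x, a)) {..<Suc 0} then f x a else 0)"
      by (auto simp: pmf_mdp_step)
  qed simp
  also have "\<dots> = f x a"
    by (subst sum.delta) (auto simp: finite_PiE)
  finally show ?case by (simp add: split_beta)
next
  \<comment> \<open>Removing the last step changes the integrand to
    \<open>next_value P \<pi> f\<close>, hence the induction over all \<open>f\<close>.\<close>
  case (Suc t)
  show ?case
    unfolding expectation_trajectory_Suc[where f=f] Suc.IH[of "next_value P \<pi> f"] by (simp add: funpow_swap1)
qed

text \<open>Expectation and discounted sum may be exchanged because the terms are dominated by a
  geometric series; each expectation is then an iterate of the averaging operator.\<close>

lemma policy_Q_series: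
  fixes P :: "'x::finite \<Rightarrow> 'a::finite \<Rightarrow> 'x pmf"
  assumes \<gamma>: "0 \<le> \<gamma>" "\<gamma> < 1"
  shows "(\<lambda>t. \<gamma> ^ t * (next_value P \<pi> ^^ t) r x a) sums policy_Q P \<gamma> r \<pi> x a"
proof -
  let ?M = "trajectory P \<pi> (x, a)"
  let ?f = "\<lambda>t \<omega>. \<gamma> ^ t * r (fst (\<omega> t)) (snd (\<omega> t))"
  interpret prob_space ?M by (rule prob_space_trajectory)
  have [measurable_cong]: "sets ?M = sets (PiM UNIV (\<lambda>_. count_space UNIV))" by (rule sets_trajectory)
  \<comment> \<open>A crude uniform bound on the reward, available since there are finitely many
    state-action pairs.\<close>
  define B where "B = (\<Sum>w\<in>UNIV. \<bar>case_prod r w\<bar>)"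
  have B: "\<bar>r x a\<bar> \<le> B" for x a
    unfolding B_def using member_le_sum[of "(x, a)" UNIV "\<lambda>w. \<bar>case_prod r w\<bar>"] by simp
  have meas: "(\<lambda>\<omega>. r (fst (\<omega> t)) (snd (\<omega> t))) \<in> borel_measurable ?M" for t
    by (rule measurable_compose[of "\<lambda>\<omega>. \<omega> t" _ "count_space UNIV" "\<lambda>p. r (fst p) (snd p)"]) measurable
  have bound: "norm (?f t \<omega>) \<le> \<gamma> ^ t * B" for t \<omega>
    using B \<gamma>(1) by (simp add: abs_mult mult_left_mono)
  have geo: "summable (\<lambda>t. \<gamma> ^ t * B)"
    using \<gamma> by (intro summable_mult2 summable_geometric) simp
  have int: "integrable ?M (?f t)" for t
    by (rule integrable_const_bound[where B="\<gamma> ^ t * B"]) (use bound meas in auto)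
  have "(\<lambda>t. \<integral>\<omega>. ?f t \<omega> \<partial>?M) sums (\<integral>\<omega>. (\<Sum>t. ?f t \<omega>) \<partial>?M)"
  proof (rule sums_integral[OF int])
    show "AE \<omega> in ?M. summable (\<lambda>t. norm (?f t \<omega>))"
      by (intro AE_I2 summable_comparison_test'[OF geo]) (use bound in auto)
    have "(\<integral>\<omega>. norm (?f t \<omega>) \<partial>?M) \<le> \<gamma> ^ t * B" for t
      by (rule integral_le_const) (use int bound in auto)
    then show "summable (\<lambda>t. \<integral>\<omega>. norm (?f t \<omega>) \<partial>?M)"
      by (intro summable_comparison_test'[OF geo]) auto
  qed
  then show ?thesis
    by (simp add: policy_Q_def expectation_trajectory)
qed

text \<open>Averaging and discounting the series termwise shifts it by one index, and the missing
  term at time 0 is the reward. With real values \<open>gradient_equation\<close> is the Bellman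
  equation of \<pi>.\<close>

theorem policy_Q_bellman:
  fixes P :: "'x::finite \<Rightarrow> 'a::finite \<Rightarrow> 'x pmf"
  assumes \<gamma>: "0 \<le> \<gamma>" "\<gamma> < 1"
  shows "gradient_equation P \<gamma> r \<pi> (policy_Q P \<gamma> r \<pi>)"
  unfolding gradient_equation_iff
proof (intro allI)
  fix x a
  let ?q = "policy_Q P \<gamma> r \<pi>"
  have "(\<lambda>t. next_value P \<pi> (\<lambda>x a. \<gamma> ^ t * (next_value P \<pi> ^^ t) r x a) x a) sums next_value P \<pi> ?q x a"
    unfolding next_value_def[of P \<pi> ?q] next_value_def[of P \<pi> "\<lambda>x a. \<gamma> ^ _ * _ x a"]
    by (intro sums_sum sums_scaleR_right policy_Q_series[OF \<gamma>])
  then have "(\<lambda>t. \<gamma> * next_value P \<pi> (\<lambda>x a. \<gamma> ^ t * (next_value P \<pi> ^^ t) r x a) x a)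
      sums (\<gamma> * next_value P \<pi> ?q x a)"
    by (rule sums_mult)
  moreover have "\<gamma> * next_value P \<pi> (\<lambda>x a. \<gamma> ^ t * (next_value P \<pi> ^^ t) r x a) x a
      = \<gamma> ^ Suc t * (next_value P \<pi> ^^ Suc t) r x a" for t
    by (simp add: next_value_def sum_distrib_left algebra_simps)
  ultimately have "(\<lambda>t. \<gamma> ^ Suc t * (next_value P \<pi> ^^ Suc t) r x a) sums (\<gamma> * next_value P \<pi> ?q x a)"
    by simp
  then have "(\<lambda>t. \<gamma> ^ t * (next_value P \<pi> ^^ t) r x a) sums (\<gamma> * next_value P \<pi> ?q x a + r x a)"
    using sums_Suc_iff[of "\<lambda>t. \<gamma> ^ t * (next_value P \<pi> ^^ t) r x a"] by simp
  from sums_unique2[OF policy_Q_series[OF \<gamma>] this]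
  show "?q x a = r x a + \<gamma> *\<^sub>R next_value P \<pi> ?q x a" by simp
qed

section \<open>Linearity in the reward and gradients for a fixed policy\<close>

text \<open>The discounted occupation measure: the expected discounted number of visits to
  \<open>w\<close>, as a function of the starting pair.\<close>

definition occupancy ::
  "('x::finite \<Rightarrow> 'a::finite \<Rightarrow> 'x pmf) \<Rightarrow> real \<Rightarrow> ('x \<Rightarrow> 'a pmf) \<Rightarrow> 'x \<times> 'a \<Rightarrow> 'x \<Rightarrow> 'a \<Rightarrow> real"
where
  "occupancy P \<gamma> \<pi> w = policy_Q P \<gamma> (\<lambda>x a. if (x, a) = w then 1 else 0) \<pi>"

text \<open>Superposition of the solutions for indicator rewards. This gives existence of a solution
  for vector-valued rewards, in particular for the derivatives of the reward.\<close>

lemma gradient_equation_occupancy: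
  fixes v :: "'x::finite \<Rightarrow> 'a::finite \<Rightarrow> 'v::real_normed_vector"
  assumes "0 \<le> \<gamma>" "\<gamma> < 1"
  shows "gradient_equation P \<gamma> v \<pi> (\<lambda>x a. \<Sum>w\<in>UNIV. occupancy P \<gamma> \<pi> w x a *\<^sub>R case_prod v w)"
  unfolding gradient_equation_iff
proof (intro allI)
  fix x a
  have "occupancy P \<gamma> \<pi> w x a = (if (x, a) = w then 1 else 0) + \<gamma> * next_value P \<pi> (occupancy P \<gamma> \<pi> w) x a" for w
    using policy_Q_bellman[OF assms, of P "\<lambda>x a. if (x, a) = w then 1 else 0" \<pi>]
    by (simp add: gradient_equation_iff occupancy_def)
  then have "(\<Sum>w\<in>UNIV. occupancy P \<gamma> \<pi> w x a *\<^sub>R case_prod v w)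
      = (\<Sum>w\<in>UNIV. ((if (x, a) = w then 1 else 0) + \<gamma> * next_value P \<pi> (occupancy P \<gamma> \<pi> w) x a) *\<^sub>R case_prod v w)"
    by (intro sum.cong arg_cong2[where f=scaleR] refl)
  also have "\<dots> = (\<Sum>w\<in>UNIV. if (x, a) = w then case_prod v w else 0)
      + (\<Sum>w\<in>UNIV. \<gamma> *\<^sub>R next_value P \<pi> (occupancy P \<gamma> \<pi> w) x a *\<^sub>R case_prod v w)"
    unfolding sum.distrib[symmetric] by (rule sum.cong) (auto simp: scaleR_add_left)
  finally show "(\<Sum>w\<in>UNIV. occupancy P \<gamma> \<pi> w x a *\<^sub>R case_prod v w) = v x a
      + \<gamma> *\<^sub>R next_value P \<pi> (\<lambda>x a. \<Sum>w\<in>UNIV. occupancy P \<gamma> \<pi> w x a *\<^sub>R case_prod v w) x a"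
    by (simp add: next_value_sum_scaleR scaleR_sum_right)
qed

text \<open>Both sides solve the same Bellman equation. The coefficients do not involve the reward,
  so the action values are linear in it.\<close>

lemma policy_Q_eq_occupancy:
  fixes P :: "'x::finite \<Rightarrow> 'a::finite \<Rightarrow> 'x pmf"
  assumes "0 \<le> \<gamma>" "\<gamma> < 1"
  shows "policy_Q P \<gamma> r \<pi> x a = (\<Sum>w\<in>UNIV. occupancy P \<gamma> \<pi> w x a * case_prod r w)"
proof -
  have "policy_Q P \<gamma> r \<pi> = (\<lambda>x a. \<Sum>w\<in>UNIV. occupancy P \<gamma> \<pi> w x a *\<^sub>R case_prod r w)"
    by (rule gradient_equation_unique[OF assms policy_Q_bellman[OF assms] gradient_equation_occupancy[OF assms]])
  then show ?thesis by (simp only: real_scaleR_def)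
qed

text \<open>The occupancies do not depend on \<theta>, so the derivative passes to the rewards. The
  resulting gradient is exactly the solution from
  \<open>gradient_equation_occupancy\<close>.\<close>

lemma GDERIV_policy_Q:
  assumes "0 \<le> \<gamma>" "\<gamma> < 1"
    and "\<And>x a. GDERIV (\<lambda>\<eta>. r \<eta> x a) \<theta> :> r' x a"
  shows "GDERIV (\<lambda>\<eta>. policy_Q P \<gamma> (r \<eta>) \<pi> x a) \<theta> :> (\<Sum>w\<in>UNIV. occupancy P \<gamma> \<pi> w x a *\<^sub>R case_prod r' w)"
proof -
  have "((\<lambda>\<eta>. occupancy P \<gamma> \<pi> w x a * case_prod (r \<eta>) w) has_derivative
      (\<lambda>h. occupancy P \<gamma> \<pi> w x a * (h \<bullet> case_prod r' w))) (at \<theta>)" for w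
    using assms(3) by (intro has_derivative_mult_right) (simp add: gderiv_def split_beta)
  then show ?thesis
    unfolding policy_Q_eq_occupancy[OF assms(1,2)] gderiv_def inner_sum_right inner_scaleR_right
    by (rule has_derivative_sum)
qed

text \<open>The difference of the two Bellman equations has a source term of at most
  \<open>c\<close>, so the comparison principle applies.\<close>

lemma policy_Q_lipschitz_reward:
  fixes P :: "'x::finite \<Rightarrow> 'a::finite \<Rightarrow> 'x pmf"
  assumes \<gamma>: "0 \<le> \<gamma>" "\<gamma> < 1"
    and "\<And>x a. \<bar>r x a - s x a\<bar> \<le> c"
  shows "policy_Q P \<gamma> r \<pi> x a \<le> policy_Q P \<gamma> s \<pi> x a + c / (1 - \<gamma>)"
proof -
  let ?u = "\<lambda>x a. policy_Q P \<gamma> r \<pi> x a - policy_Q P \<gamma> s \<pi> x a"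
  have "?u x a \<le> c + \<gamma> * next_value P \<pi> ?u x a" for x a
  proof -
    have "?u x a = r x a - s x a + \<gamma> * next_value P \<pi> ?u x a"
    proof -
      have "policy_Q P \<gamma> t \<pi> x a = t x a + \<gamma> * next_value P \<pi> (policy_Q P \<gamma> t \<pi>) x a" for t
        using policy_Q_bellman[OF \<gamma>, of P t \<pi>] by (simp add: gradient_equation_iff)
      from this[of r] this[of s] show ?thesis
        unfolding next_value_diff right_diff_distrib by linarith
    qed
    then show ?thesis using assms(3)[of x a] by linarith
  qed
  from discounted_comparison[OF \<gamma> this, of x a] show ?thesis by simp
qed

section \<open>Greedy policies and optimality\<close>

text \<open>A convex combination is at most the maximum, and a greedy policy attains that maximum in
  every state.\<close>

lemma next_value_le_greedy:
  fixes f :: "'x::finite \<Rightarrow> 'a::finite \<Rightarrow> real"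
  assumes "greedy \<pi> f"
  shows "next_value P \<sigma> f x a \<le> next_value P \<pi> f x a"
proof -
  have le: "(\<Sum>b\<in>UNIV. pmf (\<sigma> y) b * f y b) \<le> (\<Sum>b\<in>UNIV. pmf (\<pi> y) b * f y b)" for y
  proof -
    have "(\<Sum>b\<in>UNIV. pmf (\<sigma> y) b * f y b) \<le> (\<Sum>b\<in>UNIV. pmf (\<sigma> y) b * Max (range (f y)))"
      by (intro sum_mono mult_left_mono) auto
    also have "\<dots> = Max (range (f y))"
      by (simp add: sum_pmf_eq_1 flip: sum_distrib_right)
    finally show ?thesis using assms by (simp add: greedy_def)
  qed
  show ?thesis
    unfolding next_value_def real_scaleR_def by (rule sum_mono) (rule mult_left_mono[OF le pmf_nonneg])
qed

text \<open>Over finite state and action types there are only finitely many maps \<open>d\<close>;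
  this finiteness yields a best policy and later a finite union of null sets.\<close>

definition deterministic :: "('x \<Rightarrow> 'a) \<Rightarrow> 'x \<Rightarrow> 'a pmf" where
  "deterministic d x = return_pmf (d x)"

lemma greedy_deterministic_exists:
  fixes f :: "'x::finite \<Rightarrow> 'a::finite \<Rightarrow> real"
  obtains d where "greedy (deterministic d) f"
proof -
  have "\<exists>b. f y b = Max (range (f y))" for y
  proof -
    have "Max (range (f y)) \<in> range (f y)" by (rule Max_in) auto
    then show ?thesis by (metis rangeE)
  qed
  then obtain d where d: "\<And>y. f y (d y) = Max (range (f y))" by metis
  have "greedy (deterministic d) f"
    unfolding greedy_def deterministic_def
    by (simp add: pmf_return d[symmetric] indicator_def if_distrib[of "\<lambda>c. c * _"] cong: if_cong)
  then show thesis by (rule that)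
qed

text \<open>Verification: the hypotheses say that \<open>q\<close> solves the Bellman optimality
  equation. Replacing \<sigma> by \<pi> can only lower the average of \<open>q\<close>, so
  comparison with \<open>c = 0\<close> applies to the difference.\<close>

lemma policy_Q_le_of_greedy_fixpoint:
  fixes q :: "'x::finite \<Rightarrow> 'a::finite \<Rightarrow> real"
  assumes \<gamma>: "0 \<le> \<gamma>" "\<gamma> < 1"
    and "greedy \<sigma> q" "gradient_equation P \<gamma> r \<sigma> q"
  shows "policy_Q P \<gamma> r \<pi> x a \<le> q x a"
proof -
  let ?u = "\<lambda>x a. policy_Q P \<gamma> r \<pi> x a - q x a"
  have "?u x a \<le> 0 + \<gamma> * next_value P \<pi> ?u x a" for x a
  proof -
    have "policy_Q P \<gamma> r \<pi> x a = r x a + \<gamma> * next_value P \<pi> (policy_Q P \<gamma> r \<pi>) x a"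
      using policy_Q_bellman[OF \<gamma>, of P r \<pi>] by (simp add: gradient_equation_iff)
    moreover have "q x a = r x a + \<gamma> * next_value P \<sigma> q x a"
      using assms(4) by (simp add: gradient_equation_iff)
    moreover have "\<gamma> * next_value P \<pi> q x a \<le> \<gamma> * next_value P \<sigma> q x a"
      by (intro mult_left_mono next_value_le_greedy assms)
    ultimately show ?thesis by (simp add: next_value_diff right_diff_distrib)
  qed
  from discounted_comparison[OF \<gamma> this, of x a] show ?thesis by simp
qed

text \<open>
  Among the finitely many deterministic policies take one maximising the sum of all action
  values: making it greedy cannot improve it, so its action-value function solves the Bellman
  optimality equation.
\<close>

lemma optimal_deterministic_policy:
  fixes P :: "'x::finite \<Rightarrow> 'a::finite \<Rightarrow> 'x pmf"
  assumes \<gamma>: "0 \<le> \<gamma>" "\<gamma> < 1"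
  obtains d where "optimal_Q P \<gamma> r = policy_Q P \<gamma> r (deterministic d)"
    and "greedy (deterministic d) (optimal_Q P \<gamma> r)"
proof -
  define Q where "Q d = policy_Q P \<gamma> r (deterministic d)" for d
  define S where "S d = (\<Sum>x\<in>UNIV. \<Sum>a\<in>UNIV. Q d x a)" for d
  have Q: "gradient_equation P \<gamma> r (deterministic d) (Q d)" for d
    unfolding Q_def by (rule policy_Q_bellman[OF \<gamma>])
  have "Max (range S) \<in> range S" by (rule Max_in) auto
  then obtain d where Max_S: "Max (range S) = S d" by (rule rangeE)
  have d: "S d' \<le> S d" for d'
    unfolding Max_S[symmetric] by (rule Max_ge) auto
  obtain d' where d': "greedy (deterministic d') (Q d)"
    by (rule greedy_deterministic_exists)
  let ?u = "\<lambda>x a. Q d x a - Q d' x a"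
  have "?u x a \<le> 0 + \<gamma> * next_value P (deterministic d') ?u x a" for x a
  proof -
    have "\<gamma> * next_value P (deterministic d) (Q d) x a \<le> \<gamma> * next_value P (deterministic d') (Q d) x a"
      by (intro mult_left_mono next_value_le_greedy d' \<gamma>)
    moreover have "Q e x a = r x a + \<gamma> * next_value P (deterministic e) (Q e) x a" for e
      using Q[of e] by (simp add: gradient_equation_iff)
    from this[of d] this[of d'] have "?u x a = \<gamma> * next_value P (deterministic d) (Q d) x a
        - \<gamma> * next_value P (deterministic d') (Q d') x a" by linarith
    ultimately show ?thesis by (simp add: next_value_diff right_diff_distrib)
  qed
  from discounted_comparison[OF \<gamma> this] have le: "Q d x a \<le> Q d' x a" for x a by simp
  \<comment> \<open>A strict improvement at a single pair would raise the total \<open>S\<close>,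
    against the choice of \<open>d\<close>. Equality makes \<open>d'\<close> greedy for its own
    action values.\<close>
  have "Q d = Q d'"
  proof (rule ccontr)
    assume "Q d \<noteq> Q d'"
    then obtain x a where "Q d x a \<noteq> Q d' x a" by (auto simp: fun_eq_iff)
    with le[of x a] have lt: "Q d x a < Q d' x a" by simp
    have "S d < S d'"
      unfolding S_def
    proof (rule sum_strict_mono_ex1)
      show "\<forall>x\<in>UNIV. (\<Sum>a\<in>UNIV. Q d x a) \<le> (\<Sum>a\<in>UNIV. Q d' x a)" by (simp add: le sum_mono)
      have "(\<Sum>a\<in>UNIV. Q d x a) < (\<Sum>a\<in>UNIV. Q d' x a)"
        by (rule sum_strict_mono_ex1) (use le lt in auto)
      then show "\<exists>x\<in>UNIV. (\<Sum>a\<in>UNIV. Q d x a) < (\<Sum>a\<in>UNIV. Q d' x a)" by auto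
    qed simp
    with d[of d'] show False by simp
  qed
  with d' have greedy: "greedy (deterministic d') (Q d')" by simp
  have "optimal_Q P \<gamma> r = Q d'"
  proof (intro ext)
    fix x a
    show "optimal_Q P \<gamma> r x a = Q d' x a"
      unfolding optimal_Q_def
    proof (rule cSup_eq_maximum)
      show "Q d' x a \<in> range (\<lambda>\<pi>. policy_Q P \<gamma> r \<pi> x a)" by (simp add: Q_def)
      show "q \<le> Q d' x a" if "q \<in> range (\<lambda>\<pi>. policy_Q P \<gamma> r \<pi> x a)" for q
        using that policy_Q_le_of_greedy_fixpoint[OF \<gamma> greedy Q] by auto
    qed
  qed
  with greedy that[of d'] show thesis by (simp add: Q_def)
qed

lemma policy_Q_le_optimal_Q:
  fixes P :: "'x::finite \<Rightarrow> 'a::finite \<Rightarrow> 'x pmf"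
  assumes \<gamma>: "0 \<le> \<gamma>" "\<gamma> < 1"
  shows "policy_Q P \<gamma> r \<pi> x a \<le> optimal_Q P \<gamma> r x a"
proof -
  obtain d where d: "optimal_Q P \<gamma> r = policy_Q P \<gamma> r (deterministic d)"
    and greedy: "greedy (deterministic d) (optimal_Q P \<gamma> r)"
    by (rule optimal_deterministic_policy[OF \<gamma>])
  show ?thesis
    using greedy policy_Q_bellman[OF \<gamma>] unfolding d
    by (intro policy_Q_le_of_greedy_fixpoint[OF \<gamma>])
qed

text \<open>All greedy policies give the optimal action values the same one-step average, so these
  solve the Bellman equation of \<pi> too, and uniqueness applies. Randomised greedy policies are
  included.\<close>

lemma policy_Q_greedy_eq_optimal_Q:
  fixes P :: "'x::finite \<Rightarrow> 'a::finite \<Rightarrow> 'x pmf"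
  assumes \<gamma>: "0 \<le> \<gamma>" "\<gamma> < 1"
    and greedy: "greedy \<pi> (optimal_Q P \<gamma> r)"
  shows "policy_Q P \<gamma> r \<pi> = optimal_Q P \<gamma> r"
proof -
  let ?q = "optimal_Q P \<gamma> r"
  obtain d where d: "?q = policy_Q P \<gamma> r (deterministic d)" and greedy_d: "greedy (deterministic d) ?q"
    by (rule optimal_deterministic_policy[OF \<gamma>])
  have "gradient_equation P \<gamma> r (deterministic d) ?q"
    unfolding d by (rule policy_Q_bellman[OF \<gamma>])
  moreover have "next_value P (deterministic d) ?q x a = next_value P \<pi> ?q x a" for x a
    by (intro antisym next_value_le_greedy greedy greedy_d)
  ultimately have "gradient_equation P \<gamma> r \<pi> ?q"
    by (simp add: gradient_equation_iff)
  with gradient_equation_unique[OF \<gamma> policy_Q_bellman[OF \<gamma>]] show ?thesis .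
qed

text \<open>A policy optimal for \<open>r\<close> competes in the problem with reward
  \<open>s\<close>, where its values drop by at most \<open>c / (1 - \<gamma>)\<close>; then the
  roles are exchanged.\<close>

lemma optimal_Q_lipschitz_reward:
  fixes P :: "'x::finite \<Rightarrow> 'a::finite \<Rightarrow> 'x pmf"
  assumes \<gamma>: "0 \<le> \<gamma>" "\<gamma> < 1"
    and rs: "\<And>x a. \<bar>r x a - s x a\<bar> \<le> c"
  shows "\<bar>optimal_Q P \<gamma> r x a - optimal_Q P \<gamma> s x a\<bar> \<le> c / (1 - \<gamma>)"
proof -
  have "optimal_Q P \<gamma> r x a \<le> optimal_Q P \<gamma> s x a + c / (1 - \<gamma>)"
    if rs: "\<And>x a. \<bar>r x a - s x a\<bar> \<le> c" for r s
  proof -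
    obtain d where "optimal_Q P \<gamma> r = policy_Q P \<gamma> r (deterministic d)"
      by (rule optimal_deterministic_policy[OF \<gamma>])
    then show ?thesis
      using policy_Q_lipschitz_reward[OF \<gamma> rs, where P=P and \<pi>="deterministic d"]
        policy_Q_le_optimal_Q[OF \<gamma>, where P=P and r=s and \<pi>="deterministic d"] by (simp only:) (rule order_trans, assumption, simp)
  qed
  from this[of r s] this[of s r] rs show ?thesis
    by (fastforce simp: abs_le_iff abs_minus_commute)
qed

section \<open>Level sets with nonzero gradient are null\<close>

text \<open>As the width tends to 0 the slabs decrease to a part of the hyperplane orthogonal to
  \<open>D\<close>, which is null; continuity from above gives the claim.\<close>

lemma thin_slab_measure:
  fixes D :: "'v::euclidean_space"
  assumes "D \<noteq> 0" "0 < e"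
  obtains \<eta> where "0 < \<eta>" "measure lebesgue (ball 0 1 \<inter> {y. \<bar>D \<bullet> y\<bar> \<le> \<eta>}) < e"
proof -
  define A where "A n = ball 0 1 \<inter> {y. \<bar>D \<bullet> y\<bar> \<le> 1 / real (Suc n)}" for n
  have closed: "closed {y. \<bar>D \<bullet> y\<bar> \<le> c}" for c
    by (intro closed_Collect_le continuous_intros)
  have A: "A n \<in> lmeasurable" for n
    unfolding A_def by (intro fmeasurable_Int_fmeasurable lmeasurable_ball) (use closed in auto)
  have "(\<lambda>n. measure lebesgue (A n)) \<longlonglongrightarrow> measure lebesgue (\<Inter>n. A n)"
  proof (rule Lim_measure_decseq)
    show "decseq A"
      unfolding decseq_def A_def
      by (auto intro: order_trans simp: frac_le)
    show "range A \<subseteq> sets lebesgue" using A by auto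
    show "emeasure lebesgue (A n) \<noteq> \<infinity>" for n using fmeasurableD2[OF A] by simp
  qed
  moreover have "negligible (\<Inter>n. A n)"
  proof (rule negligible_subset[OF negligible_hyperplane[of D 0]])
    show "D \<noteq> 0 \<or> (0::real) \<noteq> 0" using assms(1) by simp
    show "(\<Inter>n. A n) \<subseteq> {x. D \<bullet> x = 0}"
    proof
      fix y assume y: "y \<in> (\<Inter>n. A n)"
      have "\<bar>D \<bullet> y\<bar> \<le> 0"
      proof (rule ccontr)
        assume "\<not> \<bar>D \<bullet> y\<bar> \<le> 0"
        then obtain n where "1 / real (Suc n) < \<bar>D \<bullet> y\<bar>"
          using reals_Archimedean[of "\<bar>D \<bullet> y\<bar>"] by (auto simp: inverse_eq_divide)
        moreover have "\<bar>D \<bullet> y\<bar> \<le> 1 / real (Suc n)" using y by (auto simp: A_def)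
        ultimately show False by simp
      qed
      then show "y \<in> {x. D \<bullet> x = 0}" by simp
    qed
  qed
  ultimately have "(\<lambda>n. measure lebesgue (A n)) \<longlonglongrightarrow> 0"
    by (simp add: negligible_imp_measure0)
  then have "\<forall>\<^sub>F n in sequentially. measure lebesgue (A n) < e"
    using assms(2) by (rule order_tendstoD)
  then obtain n where "measure lebesgue (A n) < e"
    using eventually_happens by fastforce
  then show thesis
    by (intro that[of "1 / real (Suc n)"]) (simp_all add: A_def)
qed

text \<open>
  Near a point with nonzero gradient the level set lies in a slab that is thin relative to the radius of the
  ball, so the set has no point of positive density. Only differentiability is needed, not
  continuity of the gradient.
\<close>

theorem negligible_level_set_nonzero_gradient:
  fixes h :: "'v::euclidean_space \<Rightarrow> real"
  shows "negligible {x. h x = c \<and> (\<exists>D. (GDERIV h x :> D) \<and> D \<noteq> 0)}" (is "negligible ?S")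
  unfolding negligible_eq_zero_density
proof (intro ballI allI impI)
  fix x and r e :: real
  assume "x \<in> ?S" and r: "0 < r" and e: "0 < e"
  then obtain D where hx: "h x = c" and deriv: "GDERIV h x :> D" and "D \<noteq> 0" by auto
  \<comment> \<open>The slab is to fill less than the fraction \<open>e\<close> of the unit ball,
    hence the tolerance \<open>e * ?b\<close>.\<close>
  let ?b = "measure lebesgue (ball (0::'v) 1)"
  have "0 < ?b" by (simp add: measure_completion)
  then obtain \<eta> where \<eta>: "0 < \<eta>" and slab: "measure lebesgue (ball 0 1 \<inter> {y. \<bar>D \<bullet> y\<bar> \<le> \<eta>}) < e * ?b"
    using thin_slab_measure[OF \<open>D \<noteq> 0\<close>, of "e * ?b"] e by auto
  from deriv \<eta> obtain d0 where "0 < d0"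
    and d0: "\<And>y. norm (y - x) < d0 \<Longrightarrow> norm (h y - h x - (y - x) \<bullet> D) \<le> \<eta> * norm (y - x)"
    unfolding gderiv_def has_derivative_at_alt by blast
  define d where "d = min r d0"
  have d: "0 < d" "d \<le> r" "d \<le> d0" using r \<open>0 < d0\<close> by (auto simp: d_def)
  define U where "U = ball x d \<inter> {y. \<bar>D \<bullet> (y - x)\<bar> \<le> \<eta> * d}"
  \<comment> \<open>Scaling by \<open>d\<close> and translating to \<open>x\<close> multiplies the
    volumes of slab and ball by the same factor, so the fraction obtained in the unit ball persists
    at radius \<open>d\<close>.\<close>
  have image: "(\<lambda>y. d *\<^sub>R y + x) ` (ball 0 1 \<inter> {y. \<bar>D \<bullet> y\<bar> \<le> s}) = ball x d \<inter> {y. \<bar>D \<bullet> (y - x)\<bar> \<le> s * d}" for s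
  proof (intro set_eqI iffI)
    fix y assume "y \<in> (\<lambda>y. d *\<^sub>R y + x) ` (ball 0 1 \<inter> {y. \<bar>D \<bullet> y\<bar> \<le> s})"
    then show "y \<in> ball x d \<inter> {y. \<bar>D \<bullet> (y - x)\<bar> \<le> s * d}"
      using d by (auto simp: dist_norm abs_mult)
  next
    fix y assume "y \<in> ball x d \<inter> {y. \<bar>D \<bullet> (y - x)\<bar> \<le> s * d}"
    then show "y \<in> (\<lambda>y. d *\<^sub>R y + x) ` (ball 0 1 \<inter> {y. \<bar>D \<bullet> y\<bar> \<le> s})"
      using d by (intro image_eqI[of _ _ "(1 / d) *\<^sub>R (y - x)"])
        (simp_all add: dist_norm norm_minus_commute abs_mult divide_le_eq)
  qed
  have image_ball: "(\<lambda>y. d *\<^sub>R y + x) ` ball 0 1 = ball x d"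
  proof -
    have "(\<lambda>y. d *\<^sub>R y + x) ` ball 0 1 = (+) x ` ((*\<^sub>R) d ` ball 0 1)"
      by (simp add: image_image add.commute)
    then show ?thesis using d by (simp add: ball_scale)
  qed
  have "closed {y. \<bar>D \<bullet> (y - x)\<bar> \<le> \<eta> * d}"
    by (intro closed_Collect_le continuous_intros)
  then have "U \<in> lmeasurable"
    unfolding U_def by (intro fmeasurable_Int_fmeasurable lmeasurable_ball) auto
  moreover have "?S \<inter> ball x d \<subseteq> U"
  proof
    fix y assume y: "y \<in> ?S \<inter> ball x d"
    then have n: "norm (y - x) < d" by (simp add: dist_norm norm_minus_commute)
    \<comment> \<open>On the level set \<open>h y = h x\<close>, so only the linear term remains in
      the differentiability estimate.\<close>
    then have "\<bar>D \<bullet> (y - x)\<bar> \<le> \<eta> * norm (y - x)"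
      using d0[of y] y hx d by (simp add: inner_commute)
    also have "\<dots> \<le> \<eta> * d" using n \<eta> by simp
    finally show "y \<in> U" using y by (simp add: U_def)
  qed
  moreover have "measure lebesgue U < e * measure lebesgue (ball x d)"
    using measure_lebesgue_affine[of d x "ball 0 1 \<inter> {y. \<bar>D \<bullet> y\<bar> \<le> \<eta>}"]
      measure_lebesgue_affine[of d x "ball 0 1"] slab d
    unfolding image image_ball U_def[symmetric] by simp
  ultimately show "\<exists>d>0. d \<le> r \<and> (\<exists>U. ?S \<inter> ball x d \<subseteq> U \<and> U \<in> lmeasurable
      \<and> measure lebesgue U < e * measure lebesgue (ball x d))"
    using d by blast
qed

section \<open>Differentiating a selection from finitely many functions\<close>

text \<open>Near \<theta> continuity rules out the branches that differ from \<open>h\<close> at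
  \<theta>. The remaining ones share the gradient \<open>g\<close>, and their finitely many
  first-order estimates hold on a common neighbourhood.\<close>

lemma GDERIV_finite_selection:
  fixes h :: "'v::real_inner \<Rightarrow> real"
  assumes I: "finite I"
    and sel: "\<And>\<eta>. \<exists>i\<in>I. h \<eta> = F i \<eta>"
    and cont: "isCont h \<theta>"
    and deriv: "\<And>i. i \<in> I \<Longrightarrow> GDERIV (F i) \<theta> :> G i"
    and active: "\<And>i. i \<in> I \<Longrightarrow> F i \<theta> = h \<theta> \<Longrightarrow> G i = g"
  shows "GDERIV h \<theta> :> g"
  unfolding gderiv_def has_derivative_at_alt
proof (intro conjI allI impI)
  show "bounded_linear (\<lambda>h. h \<bullet> g)" by (rule bounded_linear_inner_left)
  fix e :: real assume e: "0 < e"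
  have "\<forall>\<^sub>F \<eta> in nhds \<theta>. h \<eta> = F i \<eta> \<longrightarrow> \<bar>h \<eta> - h \<theta> - (\<eta> - \<theta>) \<bullet> g\<bar> \<le> e * norm (\<eta> - \<theta>)"
    if i: "i \<in> I" for i
  proof (cases "F i \<theta> = h \<theta>")
    case True
    from deriv[OF i] e obtain d where "0 < d"
      "\<And>y. norm (y - \<theta>) < d \<Longrightarrow> norm (F i y - F i \<theta> - (y - \<theta>) \<bullet> G i) \<le> e * norm (y - \<theta>)"
      unfolding gderiv_def has_derivative_at_alt by blast
    then show ?thesis
      using active[OF i True] True unfolding eventually_nhds_metric
      by (intro exI[of _ d]) (auto simp: dist_norm)
  next
    \<comment> \<open>The branch stays different from \<open>h\<close> on a neighbourhood, so the
      implication holds vacuously there.\<close>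
    case False
    have "isCont (F i) \<theta>"
      using deriv[OF i] unfolding gderiv_def by (rule has_derivative_continuous)
    then have "isCont (\<lambda>\<eta>. F i \<eta> - h \<eta>) \<theta>" using cont by (intro continuous_intros)
    then have "((\<lambda>\<eta>. F i \<eta> - h \<eta>) \<longlongrightarrow> F i \<theta> - h \<theta>) (nhds \<theta>)"
      using tendsto_at_iff_tendsto_nhds[of "\<lambda>\<eta>. F i \<eta> - h \<eta>" \<theta>] by (simp add: isCont_def)
    then have "\<forall>\<^sub>F \<eta> in nhds \<theta>. F i \<eta> - h \<eta> \<noteq> 0"
      using False by (intro tendsto_imp_eventually_ne) auto
    then show ?thesis by eventually_elim auto
  qed
  then have "\<forall>\<^sub>F \<eta> in nhds \<theta>. \<forall>i\<in>I. h \<eta> = F i \<eta> \<longrightarrow> \<bar>h \<eta> - h \<theta> - (\<eta> - \<theta>) \<bullet> g\<bar> \<le> e * norm (\<eta> - \<theta>)"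
    using I by (intro eventually_ball_finite) auto
  then have "\<forall>\<^sub>F \<eta> in nhds \<theta>. \<bar>h \<eta> - h \<theta> - (\<eta> - \<theta>) \<bullet> g\<bar> \<le> e * norm (\<eta> - \<theta>)"
    by eventually_elim (use sel in blast)
  then show "\<exists>d>0. \<forall>y. norm (y - \<theta>) < d \<longrightarrow> norm (h y - h \<theta> - (y - \<theta>) \<bullet> g) \<le> e * norm (y - \<theta>)"
    by (auto simp: eventually_nhds_metric dist_norm)
qed

text \<open>The difference \<open>g - f\<close> attains its minimum 0 at \<theta>, so its gradient
  vanishes there.\<close>

lemma GDERIV_min_eq:
  assumes "GDERIV f \<theta> :> Df" "GDERIV g \<theta> :> Dg" "f \<theta> = g \<theta>" "\<And>\<eta>. f \<eta> \<le> g \<eta>"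
  shows "Df = Dg"
proof -
  have "((\<lambda>\<eta>. g \<eta> - f \<eta>) has_derivative (\<lambda>h. h \<bullet> (Dg - Df))) (at \<theta>)"
    using GDERIV_diff[OF assms(2,1)] by (simp add: gderiv_def)
  then have "(\<lambda>h. h \<bullet> (Dg - Df)) = (\<lambda>h. 0)"
    by (rule has_derivative_local_min) (simp add: assms)
  then have "(Dg - Df) \<bullet> (Dg - Df) = 0" by (rule fun_cong)
  then show ?thesis by simp
qed

theorem proposition4:
  fixes P :: "'x::finite \<Rightarrow> 'a::finite \<Rightarrow> 'x pmf"
    and \<gamma> :: real
    and r :: "real ^ 'd \<Rightarrow> 'x \<Rightarrow> 'a \<Rightarrow> real"
    and r' :: "real ^ 'd \<Rightarrow> 'x \<Rightarrow> 'a \<Rightarrow> real ^ 'd"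
  assumes "0 \<le> \<gamma>" and "\<gamma> < 1"
    and "\<And>\<theta> x a. GDERIV (\<lambda>\<eta>. r \<eta> x a) \<theta> :> r' \<theta> x a"
    and "bdd_above (range (\<lambda>(\<theta>, x, a). norm (r' \<theta> x a)))"
  shows "(\<exists>L'>0. \<forall>x a \<theta> \<theta>'.
           \<bar>optimal_Q P \<gamma> (r \<theta>) x a - optimal_Q P \<gamma> (r \<theta>') x a\<bar> \<le> L' * norm (\<theta> - \<theta>')) \<and>
         (AE \<theta> in lebesgue. \<exists>g.
           (\<forall>x a. GDERIV (\<lambda>\<eta>. optimal_Q P \<gamma> (r \<eta>) x a) \<theta> :> g x a) \<and>
           (\<forall>\<pi>. greedy \<pi> (optimal_Q P \<gamma> (r \<theta>)) \<longrightarrow>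
              (\<exists>!\<phi>. gradient_equation P \<gamma> (r' \<theta>) \<pi> \<phi>) \<and>
              (\<forall>\<phi>. gradient_equation P \<gamma> (r' \<theta>) \<pi> \<phi> \<longrightarrow> (\<forall>x a. g x a = \<phi> x a))))"
proof
  note \<gamma> = assms(1,2)
  let ?q = "\<lambda>\<theta>. optimal_Q P \<gamma> (r \<theta>)"
  let ?f = "\<lambda>\<pi> \<theta>. policy_Q P \<gamma> (r \<theta>) \<pi>"
  define G where "G \<pi> \<theta> x a = (\<Sum>w\<in>UNIV. occupancy P \<gamma> \<pi> w x a *\<^sub>R case_prod (r' \<theta>) w)" for \<pi> \<theta> x a
  have G: "GDERIV (\<lambda>\<eta>. ?f \<pi> \<eta> x a) \<theta> :> G \<pi> \<theta> x a" for \<pi> \<theta> x a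
    unfolding G_def by (rule GDERIV_policy_Q[OF \<gamma> assms(3)])
  have G_eq: "gradient_equation P \<gamma> (r' \<theta>) \<pi> (G \<pi> \<theta>)" for \<pi> \<theta>
    unfolding G_def by (rule gradient_equation_occupancy[OF \<gamma>])
  from assms(4) obtain B0 where B0: "norm (r' \<theta> x a) \<le> B0" for \<theta> x a
    unfolding bdd_above_def by auto
  \<comment> \<open>The maximum with 1 makes the Lipschitz constant
    \<open>B / (1 - \<gamma>)\<close> strictly positive.\<close>
  define B where "B = max B0 1"
  have B: "0 < B" "\<And>\<theta> x a. norm (r' \<theta> x a) \<le> B"
    using B0 by (auto simp: B_def intro: max.coboundedI1)
  have r_lip: "\<bar>r \<theta> x a - r \<theta>' x a\<bar> \<le> B * norm (\<theta> - \<theta>')" for \<theta> \<theta>' x a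
  proof -
    have "norm (r \<theta> x a - r \<theta>' x a) \<le> B * norm (\<theta> - \<theta>')"
    proof (rule differentiable_bound[of UNIV _ "\<lambda>\<eta> h. h \<bullet> r' \<eta> x a"])
      show "((\<lambda>\<eta>. r \<eta> x a) has_derivative (\<lambda>h. h \<bullet> r' \<eta> x a)) (at \<eta>)" for \<eta>
        using assms(3) by (simp add: gderiv_def)
      show "onorm (\<lambda>h. h \<bullet> r' \<eta> x a) \<le> B" for \<eta>
      proof (rule onorm_le)
        fix h
        have "norm (h \<bullet> r' \<eta> x a) \<le> norm h * norm (r' \<eta> x a)"
          using Cauchy_Schwarz_ineq2[of h "r' \<eta> x a"] by simp
        also have "\<dots> \<le> B * norm h"
          using B(2)[of \<eta> x a] by (simp add: mult.commute[of B] mult_left_mono)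
        finally show "norm (h \<bullet> r' \<eta> x a) \<le> B * norm h" .
      qed
    qed auto
    then show ?thesis by simp
  qed
  have lip: "\<bar>?q \<theta> x a - ?q \<theta>' x a\<bar> \<le> B / (1 - \<gamma>) * norm (\<theta> - \<theta>')" for x a \<theta> \<theta>'
    using optimal_Q_lipschitz_reward[OF \<gamma> r_lip] by simp
  then show "\<exists>L'>0. \<forall>x a \<theta> \<theta>'. \<bar>?q \<theta> x a - ?q \<theta>' x a\<bar> \<le> L' * norm (\<theta> - \<theta>')"
    using B(1) \<gamma> by (intro exI[of _ "B / (1 - \<gamma>)"]) auto
  have cont: "isCont (\<lambda>\<eta>. ?q \<eta> x a) \<theta>" for x a \<theta>
  proof -
    have "((\<lambda>\<eta>. ?q \<eta> x a - ?q \<theta> x a) \<longlongrightarrow> 0) (at \<theta>)"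
    proof (rule Lim_null_comparison)
      show "\<forall>\<^sub>F \<eta> in at \<theta>. norm (?q \<eta> x a - ?q \<theta> x a) \<le> B / (1 - \<gamma>) * norm (\<eta> - \<theta>)"
        unfolding real_norm_def by (intro always_eventually allI lip)
      have "((\<lambda>\<eta>. B / (1 - \<gamma>) * norm (\<eta> - \<theta>)) \<longlongrightarrow> B / (1 - \<gamma>) * norm (\<theta> - \<theta>)) (at \<theta>)"
        by (intro tendsto_intros)
      then show "((\<lambda>\<eta>. B / (1 - \<gamma>) * norm (\<eta> - \<theta>)) \<longlongrightarrow> 0) (at \<theta>)" by simp
    qed
    then show ?thesis by (simp add: isCont_def LIM_zero_iff)
  qed
  \<comment> \<open>The points where two deterministic policies tie at \<open>(x, a)\<close> while
    the difference of their action values has a nonzero gradient.\<close>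
  define Z where "Z = (\<lambda>(d, d', x, a). {\<theta>.
      ?f (deterministic d) \<theta> x a - ?f (deterministic d') \<theta> x a = 0 \<and>
      (\<exists>D. (GDERIV (\<lambda>\<eta>. ?f (deterministic d) \<eta> x a - ?f (deterministic d') \<eta> x a) \<theta> :> D) \<and> D \<noteq> 0)})"
  \<comment> \<open>A finite union, fixed before any greedy policy is chosen: the same null set
    serves all of them.\<close>
  define N where "N = \<Union>(range Z)"
  have "negligible (Z i)" for i
    unfolding Z_def by (cases i) (simp only: prod.case negligible_level_set_nonzero_gradient)
  then have "negligible N"
    unfolding N_def by (intro negligible_Union) auto
  then have "AE \<theta> in lebesgue. \<theta> \<notin> N"
    by (intro AE_not_in) (simp add: negligible_iff_null_sets)
  then show "AE \<theta> in lebesgue. \<exists>g. (\<forall>x a. GDERIV (\<lambda>\<eta>. ?q \<eta> x a) \<theta> :> g x a) \<and>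
      (\<forall>\<pi>. greedy \<pi> (?q \<theta>) \<longrightarrow> (\<exists>!\<phi>. gradient_equation P \<gamma> (r' \<theta>) \<pi> \<phi>) \<and>
        (\<forall>\<phi>. gradient_equation P \<gamma> (r' \<theta>) \<pi> \<phi> \<longrightarrow> (\<forall>x a. g x a = \<phi> x a)))"
  proof eventually_elim
    fix \<theta>
    assume "\<theta> \<notin> N"
    obtain d where d: "?q \<theta> = ?f (deterministic d) \<theta>"
      by (rule optimal_deterministic_policy[OF \<gamma>])
    let ?g = "G (deterministic d) \<theta>"
    have g: "GDERIV (\<lambda>\<eta>. ?q \<eta> x a) \<theta> :> ?g x a" for x a
    proof (rule GDERIV_finite_selection[of UNIV _ "\<lambda>d \<eta>. ?f (deterministic d) \<eta> x a"])
      show "\<exists>d\<in>UNIV. ?q \<eta> x a = ?f (deterministic d) \<eta> x a" for \<eta>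
        by (rule optimal_deterministic_policy[OF \<gamma>, of P "r \<eta>"]) auto
      show "G (deterministic d') \<theta> x a = ?g x a" if "?f (deterministic d') \<theta> x a = ?q \<theta> x a" for d'
      proof -
        \<comment> \<open>At \<theta> both \<open>d'\<close> and \<open>d\<close> attain the optimal
          value at \<open>(x, a)\<close>; outside \<open>Z\<close> such a tie forces equal
          gradients.\<close>
        have "\<theta> \<notin> Z (d', d, x, a)" using \<open>\<theta> \<notin> N\<close> by (auto simp: N_def)
        then show ?thesis
          using that d GDERIV_diff[OF G[of "deterministic d'" x a \<theta>] G[of "deterministic d" x a \<theta>]]
          by (auto simp: Z_def)
      qed
    qed (simp_all add: cont G)
    have "?g x a = \<phi> x a" if "greedy \<pi> (?q \<theta>)" "gradient_equation P \<gamma> (r' \<theta>) \<pi> \<phi>" for \<pi> \<phi> x a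
    proof -
      \<comment> \<open>The action values of the fixed policy \<pi> stay below the optimal ones and
        agree with them at \<theta>, where \<pi> is greedy.\<close>
      have "G \<pi> \<theta> x a = ?g x a"
        by (rule GDERIV_min_eq[OF G g])
          (simp_all add: policy_Q_greedy_eq_optimal_Q[OF \<gamma> that(1)] policy_Q_le_optimal_Q[OF \<gamma>])
      with gradient_equation_unique[OF \<gamma> that(2) G_eq] show ?thesis by simp
    qed
    moreover have "\<exists>!\<phi>. gradient_equation P \<gamma> (r' \<theta>) \<pi> \<phi>" for \<pi>
      using G_eq gradient_equation_unique[OF \<gamma>] by blast
    ultimately show "\<exists>g. (\<forall>x a. GDERIV (\<lambda>\<eta>. ?q \<eta> x a) \<theta> :> g x a) \<and>
        (\<forall>\<pi>. greedy \<pi> (?q \<theta>) \<longrightarrow> (\<exists>!\<phi>. gradient_equation P \<gamma> (r' \<theta>) \<pi> \<phi>) \<and>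
          (\<forall>\<phi>. gradient_equation P \<gamma> (r' \<theta>) \<pi> \<phi> \<longrightarrow> (\<forall>x a. g x a = \<phi> x a)))"
      using g by (intro exI[of _ ?g]) simp
  qed
qed

end
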